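(* Let $J>0$. In the thermodynamic limit (number of sites $N\to\infty$, i.e. for all sufficiently large $N$), the ground state of the antiferromagnetic Heisenberg XXX Hamiltonian on $N$ qubits with periodic boundary conditions, $$H_{\mathrm{XXX}} = J\sum_{l=1}^{N}\left(\sigma_x^{l}\sigma_x^{l+1}+\sigma_y^{l}\sigma_y^{l+1}+\sigma_z^{l}\sigma_z^{l+1}\right),\qquad \vec\sigma^{\,N+1}=\vec\sigma^{\,1},$$ is an entangled state.
   Context: $\sigma_x^l,\sigma_y^l,\sigma_z^l$ denote the Pauli matrices acting on the $l$-th tensor factor of $(\mathbb{C}^2)^{\otimes N}$. A ground state is a state supported on the eigenspace of the smallest eigenvalue of the Hamiltonian. A multipartite state $\rho_{A_1A_2\cdots A_N}$ is fully separable if it can be written as $\sum_k q_k\,\rho_{A_1}^k\otimes\rho_{A_2}^k\otimes\cdots\otimes\rho_{A_N}^k$ with $0\le q_k\le 1$, $\sum_k q_k=1$ and $\rho_{A_i}^k$ density operators of subsystem $A_i$. A multipartite state is called entangled if it is not fully separable. Here the subsystems are the $N$ individual qubits. *)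

theory Defs
  imports Complex_Main "Jordan_Normal_Form.Schur_Decomposition"
begin

definition kron :: "complex mat \<Rightarrow> complex mat \<Rightarrow> complex mat" where
  "kron A B = mat (dim_row A * dim_row B) (dim_col A * dim_col B)
     (\<lambda>(i, j). A $$ (i div dim_row B, j div dim_col B) * B $$ (i mod dim_row B, j mod dim_col B))"

fun tensor_list :: "complex mat list \<Rightarrow> complex mat" where
  "tensor_list [] = 1\<^sub>m 1"
| "tensor_list (A # As) = kron A (tensor_list As)"

(* Entrywise, because matrices of unspecified dimension have no zero and
   hence no instance of the big-operator classes. *)
definition msum :: "nat \<Rightarrow> ('i \<Rightarrow> complex mat) \<Rightarrow> 'i set \<Rightarrow> complex mat" where
  "msum d F I = mat d d (\<lambda>(i, j). \<Sum>k\<in>I. F k $$ (i, j))"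

definition pauli_x :: "complex mat" where
  "pauli_x = mat_of_rows_list 2 [[0, 1], [1, 0]]"

definition pauli_y :: "complex mat" where
  "pauli_y = mat_of_rows_list 2 [[0, - \<i>], [\<i>, 0]]"

definition pauli_z :: "complex mat" where
  "pauli_z = mat_of_rows_list 2 [[1, 0], [0, - 1]]"

(* Sites are numbered 0, ..., N - 1. *)
definition site_op :: "nat \<Rightarrow> complex mat \<Rightarrow> nat \<Rightarrow> complex mat" where
  "site_op N A l = tensor_list (map (\<lambda>i. if i = l then A else 1\<^sub>m 2) [0..<N])"

definition H_XXX :: "real \<Rightarrow> nat \<Rightarrow> complex mat" where
  "H_XXX J N = complex_of_real J \<cdot>\<^sub>m msum (2 ^ N)
     (\<lambda>l. site_op N pauli_x l * site_op N pauli_x (Suc l mod N)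
        + site_op N pauli_y l * site_op N pauli_y (Suc l mod N)
        + site_op N pauli_z l * site_op N pauli_z (Suc l mod N)) {..<N}"

definition density_operator :: "nat \<Rightarrow> complex mat \<Rightarrow> bool" where
  "density_operator d \<rho> \<longleftrightarrow> \<rho> \<in> carrier_mat d d \<and> mat_adjoint \<rho> = \<rho>
     \<and> (\<forall>v\<in>carrier_vec d. 0 \<le> Re ((\<rho> *\<^sub>v v) \<bullet>c v))
     \<and> (\<Sum>i<d. \<rho> $$ (i, i)) = 1"

definition eigenspace :: "complex mat \<Rightarrow> complex \<Rightarrow> complex vec set" where
  "eigenspace A e = {v \<in> carrier_vec (dim_row A). A *\<^sub>v v = e \<cdot>\<^sub>v v}"

(* Only real eigenvalues are compared: the notion is meant for Hermitian matrices. *)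
definition smallest_eigenvalue :: "complex mat \<Rightarrow> real \<Rightarrow> bool" where
  "smallest_eigenvalue A e \<longleftrightarrow> eigenvalue A (complex_of_real e)
     \<and> (\<forall>e'. eigenvalue A (complex_of_real e') \<longrightarrow> e \<le> e')"

(* The support of a density operator is its range. *)
definition ground_state :: "complex mat \<Rightarrow> complex mat \<Rightarrow> bool" where
  "ground_state H \<rho> \<longleftrightarrow> density_operator (dim_row H) \<rho>
     \<and> (\<exists>e. smallest_eigenvalue H e
          \<and> (\<forall>v\<in>carrier_vec (dim_row H). \<rho> *\<^sub>v v \<in> eigenspace H (complex_of_real e)))"

(* The list ds holds the dimensions of the subsystems. *)
definition fully_separable :: "nat list \<Rightarrow> complex mat \<Rightarrow> bool" where
  "fully_separable ds \<rho> \<longleftrightarrow>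
     (\<exists>(m::nat) (q :: nat \<Rightarrow> real) (R :: nat \<Rightarrow> nat \<Rightarrow> complex mat).
        (\<forall>k<m. 0 \<le> q k \<and> q k \<le> 1) \<and> (\<Sum>k<m. q k) = 1
      \<and> (\<forall>k<m. \<forall>i<length ds. density_operator (ds ! i) (R k i))
      \<and> \<rho> = msum (prod_list ds)
              (\<lambda>k. complex_of_real (q k) \<cdot>\<^sub>m tensor_list (map (R k) [0..<length ds])) {..<m})"

definition entangled :: "nat list \<Rightarrow> complex mat \<Rightarrow> bool" where
  "entangled ds \<rho> \<longleftrightarrow> density_operator (prod_list ds) \<rho> \<and> \<not> fully_separable ds \<rho>"

end

theory Submission
  imports Defs
begin

text \<open>
  In a product state the energy of a bond is $J$ times the inner product of two Bloch vectors of length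
  at most one, so every fully separable state has energy at least $-JN$. A singlet on two adjacent
  sites has bond energy $-3J$, and bonds between different singlets contribute nothing; covering
  the ring with disjoint singlets therefore gives energy $-3J \<lfloor>N/2\<rfloor>$, which lies below $-JN$ as
  soon as $N \<ge> 4$. By the variational principle the smallest eigenvalue is then below $-JN$, so no
  fully separable state has the energy of a ground state.
\<close>

section \<open>Hermitian forms and the smallest eigenvalue\<close>

text \<open>Linear in \<open>x\<close> and antilinear in \<open>y\<close>. Matrices and vectors are
  plain functions read only at indices below \<open>n\<close>, so shifts and inverses become
  statements about finite sums without dimension side conditions.\<close>

definition form :: "nat \<Rightarrow> (nat \<Rightarrow> nat \<Rightarrow> complex) \<Rightarrow> (nat \<Rightarrow> complex) \<Rightarrow> (nat \<Rightarrow> complex) \<Rightarrow> complex" where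
  "form n a x y = (\<Sum>i<n. \<Sum>j<n. a i j * x j * cnj (y i))"

definition norm_sq :: "nat \<Rightarrow> (nat \<Rightarrow> complex) \<Rightarrow> real" where
  "norm_sq n x = (\<Sum>i<n. (norm (x i))\<^sup>2)"

lemma norm_sq_nonneg: "0 \<le> norm_sq n x"
  by (simp add: norm_sq_def sum_nonneg)

lemma of_real_norm_sq: "complex_of_real (norm_sq n x) = (\<Sum>i<n. x i * cnj (x i))"
  by (simp add: norm_sq_def complex_norm_square[symmetric])

text \<open>Each product of two coordinate moduli is at most \<open>norm_sq n x\<close> by the
  arithmetic-geometric mean inequality. The constant is crude, but only its finiteness matters: it
  bounds the form of an inverse and shows that some shift is admissible.\<close>

lemma form_bound:
  "norm (form n a x x) \<le> (\<Sum>i<n. \<Sum>j<n. norm (a i j)) * norm_sq n x"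
proof -
  have entry: "norm (x j) * norm (x i) \<le> norm_sq n x" if "i < n" "j < n" for i j
  proof -
    have le: "(norm (x k))\<^sup>2 \<le> norm_sq n x" if "k < n" for k
      using that unfolding norm_sq_def by (intro member_le_sum) auto
    have "2 * (norm (x j) * norm (x i)) \<le> (norm (x j))\<^sup>2 + (norm (x i))\<^sup>2"
      using sum_squares_bound[of "norm (x j)" "norm (x i)"] by (simp add: mult.assoc)
    with le[OF that(1)] le[OF that(2)] show ?thesis by linarith
  qed
  have "norm (form n a x x) \<le> (\<Sum>i<n. \<Sum>j<n. norm (a i j * x j * cnj (x i)))"
    unfolding form_def by (intro sum_norm_le norm_sum)
  also have "\<dots> \<le> (\<Sum>i<n. \<Sum>j<n. norm (a i j) * norm_sq n x)"
    by (intro sum_mono) (auto simp: norm_mult mult.assoc intro!: mult_left_mono entry)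
  finally show ?thesis by (simp add: sum_distrib_right)
qed

lemma form_diff_scaled:
  "form n a (\<lambda>i. x i - of_real t * y i) (\<lambda>i. x i - of_real t * y i)
     = form n a x x - of_real t * (form n a x y + form n a y x) + of_real (t\<^sup>2) * form n a y y"
  unfolding form_def sum_distrib_left sum.distrib[symmetric] sum_subtractf[symmetric]
  by (intro sum.cong refl) (simp add: algebra_simps power2_eq_square)

lemma form_hermitian:
  assumes "\<And>i j. i < n \<Longrightarrow> j < n \<Longrightarrow> a j i = cnj (a i j)"
  shows "form n a x y = cnj (form n a y x)"
proof -
  have "cnj (form n a y x) = (\<Sum>i<n. \<Sum>j<n. a j i * cnj (y j) * x i)"
    unfolding form_def cnj_sum by (intro sum.cong refl) (simp add: assms[symmetric])
  also have "\<dots> = form n a x y"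
    unfolding form_def by (subst sum.swap) (simp add: ac_simps)
  finally show ?thesis by simp
qed

text \<open>Positivity of the form at $x - t y$, where $y = a^{-1} x$ and $t$ is the reciprocal of a bound
  for the form of $a^{-1}$, already gives coercivity.\<close>

lemma form_coercive_if_invertible:
  assumes herm: "\<And>i j. i < n \<Longrightarrow> j < n \<Longrightarrow> a j i = cnj (a i j)"
    and psd: "\<And>x. 0 \<le> Re (form n a x x)"
    and inverse: "\<And>i j. i < n \<Longrightarrow> j < n \<Longrightarrow> (\<Sum>k<n. a i k * b k j) = (if i = j then 1 else 0)"
  shows "\<exists>c>0. \<forall>x. c * norm_sq n x \<le> Re (form n a x x)"
proof -
  \<comment> \<open>Adding 1 makes \<open>C\<close> positive even if all the norms sum to 0, as they
    do for \<open>n = 0\<close>.\<close>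
  define C where "C = (\<Sum>i<n. \<Sum>j<n. norm (b i j)) + 1"
  have C: "C > 0"
    unfolding C_def by (intro add_nonneg_pos sum_nonneg) auto
  have "norm_sq n x / C \<le> Re (form n a x x)" for x
  proof -
    define y where "y i = (\<Sum>j<n. b i j * x j)" for i
    have ay: "(\<Sum>k<n. a i k * y k) = x i" if "i < n" for i
    proof -
      have "(\<Sum>k<n. a i k * y k) = (\<Sum>k<n. \<Sum>j<n. a i k * b k j * x j)"
        by (simp add: y_def sum_distrib_left mult.assoc)
      also have "\<dots> = (\<Sum>j<n. (\<Sum>k<n. a i k * b k j) * x j)"
        by (subst sum.swap) (simp add: sum_distrib_right)
      also have "\<dots> = (\<Sum>j<n. if i = j then x j else 0)"
        using that by (intro sum.cong) (auto simp: inverse)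
      finally show ?thesis using that by simp
    qed
    have form_y: "form n a y w = (\<Sum>i<n. x i * cnj (w i))" for w
      unfolding form_def by (simp add: sum_distrib_right[symmetric] ay)
    have yx: "form n a y x = of_real (norm_sq n x)"
      by (simp add: form_y of_real_norm_sq)
    have xy: "form n a x y = of_real (norm_sq n x)"
      using form_hermitian[of n a x y, OF herm] by (simp add: yx)
    \<comment> \<open>Since \<open>a\<close> maps \<open>y\<close> to \<open>x\<close> and
      \<open>y\<close> is \<open>b\<close> applied to \<open>x\<close>, the quadratic term becomes a
      value of the form of \<open>b\<close>, to which the crude bound applies.\<close>
    have "form n a y y = cnj (form n b x x)"
      unfolding form_y by (simp add: form_def y_def sum_distrib_left mult_ac)
    then have "Re (form n a y y) \<le> norm (form n b x x)"
      by (simp add: complex_Re_le_cmod)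
    also have "\<dots> \<le> (C - 1) * norm_sq n x"
      using form_bound[of n b x] by (simp add: C_def)
    also have "\<dots> \<le> C * norm_sq n x"
      by (simp add: norm_sq_nonneg mult_right_mono)
    finally have yy: "(1 / C)\<^sup>2 * Re (form n a y y) \<le> norm_sq n x / C"
      using C by (simp add: field_simps power2_eq_square)
    \<comment> \<open>Both cross terms equal \<open>norm_sq n x\<close>. Their total of two units
      over \<open>C\<close> outweighs the at most one unit from \<open>yy\<close>.\<close>
    have "0 \<le> Re (form n a x x) - 1 / C * (2 * norm_sq n x) + (1 / C)\<^sup>2 * Re (form n a y y)"
      using psd[of "\<lambda>i. x i - of_real (1 / C) * y i"]
      unfolding form_diff_scaled xy yx of_real_add[symmetric] of_real_mult[symmetric] by simp
    with yy show ?thesis by simp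
  qed
  with C show ?thesis by (intro exI[of _ "1 / C"]) auto
qed

lemma form_shift:
  "form n (\<lambda>i j. a i j - (if i = j then of_real l else 0)) x x = form n a x x - of_real (l * norm_sq n x)"
proof -
  have "(\<Sum>j<n. (a i j - (if i = j then of_real l else 0)) * x j * cnj (x i))
      = (\<Sum>j<n. a i j * x j * cnj (x i)) - of_real l * (x i * cnj (x i))" if "i < n" for i
  proof -
    have "(\<Sum>j<n. (a i j - (if i = j then of_real l else 0)) * x j * cnj (x i))
      = (\<Sum>j<n. a i j * x j * cnj (x i)) - (\<Sum>j<n. if i = j then of_real l * (x j * cnj (x i)) else 0)"
      unfolding sum_subtractf[symmetric] by (intro sum.cong) (auto simp: algebra_simps)
    with that show ?thesis by simp
  qed
  then show ?thesis
    by (simp add: form_def sum_subtractf of_real_norm_sq sum_distrib_left)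
qed

text \<open>The largest shift that keeps the form positive semidefinite is singular by coercivity. This
  replaces the spectral theorem.\<close>

lemma exists_singular_psd_shift:
  assumes n: "n > 0" and herm: "\<And>i j. i < n \<Longrightarrow> j < n \<Longrightarrow> a j i = cnj (a i j)"
  shows "\<exists>l::real. (\<forall>x. l * norm_sq n x \<le> Re (form n a x x)) \<and>
    \<not> (\<exists>b. \<forall>i<n. \<forall>j<n. (\<Sum>k<n. (a i k - (if i = k then of_real l else 0)) * b k j)
               = (if i = j then 1 else 0))"
proof -
  define S where "S = {l. \<forall>x. l * norm_sq n x \<le> Re (form n a x x)}"
  \<comment> \<open>The crude bound makes \<open>m\<close> an admissible shift, so the set
    \<open>S\<close> of admissible shifts is nonempty.\<close>
  define m where "m = - (\<Sum>i<n. \<Sum>j<n. norm (a i j))"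
  have m: "m \<in> S"
  proof -
    have "m * norm_sq n x \<le> Re (form n a x x)" for x
      using form_bound[of n a x] abs_Re_le_cmod[of "form n a x x"] by (simp add: m_def)
    then show ?thesis by (simp add: S_def)
  qed
  \<comment> \<open>The first unit vector exists because \<open>n > 0\<close>; the value of the form
    at it bounds \<open>S\<close> from above.\<close>
  define u :: "nat \<Rightarrow> complex" where "u i = (if i = 0 then 1 else 0)" for i
  have "norm_sq n u = (\<Sum>i<n. if i = 0 then 1 else 0)"
    unfolding norm_sq_def u_def by (intro sum.cong) auto
  then have "norm_sq n u = 1" using n by simp
  then have bdd: "bdd_above S"
    by (intro bdd_aboveI[of _ "Re (form n a u u)"]) (auto simp: S_def dest: spec[of _ u])
  define l where "l = Sup S"
  have l: "l * norm_sq n x \<le> Re (form n a x x)" for x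
  proof (cases "norm_sq n x = 0")
    \<comment> \<open>Division by the norm is impossible here, but both shifts contribute 0, so the
      inequality for \<open>m\<close> is already the one for \<open>l\<close>.\<close>
    case True
    with m show ?thesis by (auto simp: S_def dest: spec[of _ x])
  next
    case False
    then have pos: "norm_sq n x > 0" using norm_sq_nonneg[of n x] by simp
    have "l \<le> Re (form n a x x) / norm_sq n x"
      unfolding l_def using m pos by (intro cSup_least) (auto simp: S_def field_simps)
    then show ?thesis using pos by (simp add: field_simps)
  qed
  let ?a = "\<lambda>i k. a i k - (if i = k then of_real l else 0)"
  have False if "\<forall>i<n. \<forall>j<n. (\<Sum>k<n. ?a i k * b k j) = (if i = j then 1 else 0)" for b
  proof -
    have "\<exists>c>0. \<forall>x. c * norm_sq n x \<le> Re (form n ?a x x)"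
    proof (rule form_coercive_if_invertible)
      show "?a j i = cnj (?a i j)" if "i < n" "j < n" for i j
        using herm[OF that] by auto
      show "0 \<le> Re (form n ?a x x)" for x
        using l[of x] by (simp add: form_shift)
      show "(\<Sum>k<n. ?a i k * b k j) = (if i = j then 1 else 0)" if "i < n" "j < n" for i j
        using that \<open>\<forall>i<n. \<forall>j<n. _ i j\<close> by blast
    qed
    then obtain c where c: "c > 0" "\<And>x. c * norm_sq n x \<le> Re (form n ?a x x)" by blast
    \<comment> \<open>Coercivity of the shifted form would leave room to shift further by
      \<open>c\<close>, past the supremum.\<close>
    have "l + c \<in> S"
      using c(2) by (auto simp: S_def form_shift algebra_simps)
    with bdd have "l + c \<le> l" unfolding l_def by (intro cSup_upper)
    with c(1) show False by simp
  qed
  with l show ?thesis by blast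
qed

section \<open>Adjoints, matrix entries and the variational principle\<close>

lemma mat_adjoint_carrier: "A \<in> carrier_mat m n \<Longrightarrow> mat_adjoint A \<in> carrier_mat n m"
  by (auto simp: mat_adjoint_def)

lemma mat_adjoint_index:
  fixes A :: "complex mat"
  assumes "i < dim_col A" "j < dim_row A"
  shows "mat_adjoint A $$ (i, j) = cnj (A $$ (j, i))"
  using assms by (simp add: mat_adjoint_def mat_of_rows_def conjugate_complex_def)

lemma mat_adjoint_eqI:
  fixes A :: "complex mat"
  assumes "A \<in> carrier_mat n n" "\<And>i j. i < n \<Longrightarrow> j < n \<Longrightarrow> cnj (A $$ (j, i)) = A $$ (i, j)"
  shows "mat_adjoint A = A"
  using assms mat_adjoint_carrier[OF assms(1)] by (intro eq_matI) (auto simp: mat_adjoint_index)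

lemma mat_adjoint_eqD:
  fixes A :: "complex mat"
  assumes "mat_adjoint A = A" "A \<in> carrier_mat n n" "i < n" "j < n"
  shows "cnj (A $$ (j, i)) = A $$ (i, j)"
  using assms mat_adjoint_index[of i A j] by simp

lemma times_mat_index:
  assumes "A \<in> carrier_mat m n" "B \<in> carrier_mat n p" "i < m" "j < p"
  shows "(A * B) $$ (i, j) = (\<Sum>k<n. A $$ (i, k) * B $$ (k, j))"
  using assms by (simp add: scalar_prod_def lessThan_atLeast0)

text \<open>Variational principle. The singular shift \<open>l\<close> is a real eigenvalue, so
  \<open>e\<close> is at most \<open>l\<close>, and \<open>l\<close> bounds the form from below by
  construction.\<close>

lemma smallest_eigenvalue_le_form:
  assumes A: "A \<in> carrier_mat n n" and n: "n > 0" and herm: "mat_adjoint A = A"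
    and e: "smallest_eigenvalue A e"
  shows "e * norm_sq n x \<le> Re (form n (\<lambda>i j. A $$ (i, j)) x x)"
proof -
  let ?a = "\<lambda>i j. A $$ (i, j)"
  have herm': "?a j i = cnj (?a i j)" if "i < n" "j < n" for i j
    using mat_adjoint_eqD[OF herm A that(2) that(1)] by simp
  from exists_singular_psd_shift[of n ?a, OF n herm'] obtain l where
    l: "\<And>x. l * norm_sq n x \<le> Re (form n ?a x x)" and
    sing: "\<not> (\<exists>b. \<forall>i<n. \<forall>j<n. (\<Sum>k<n. (?a i k - (if i = k then of_real l else 0)) * b k j)
               = (if i = j then 1 else 0))"
    by blast
  let ?M = "char_matrix A (of_real l)"
  have M: "?M \<in> carrier_mat n n" using A by simp
  have "det ?M = 0"
  proof (rule ccontr)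
    assume "det ?M \<noteq> 0"
    \<comment> \<open>An inverse of the characteristic matrix would be a right inverse of the
      shifted form. The last argument only fills the extension slot of the ring record.\<close>
    from det_non_zero_imp_unit[OF M this, of undefined]
    obtain B where B: "B \<in> carrier_mat n n" "?M * B = 1\<^sub>m n"
      unfolding Units_def ring_mat_def by auto
    have "(\<Sum>k<n. (?a i k - (if i = k then of_real l else 0)) * B $$ (k, j))
               = (if i = j then 1 else 0)" if "i < n" "j < n" for i j
    proof -
      have "(\<Sum>k<n. ?M $$ (i, k) * B $$ (k, j)) = (if i = j then 1 else 0)"
        using times_mat_index[OF M B(1) that] that by (simp add: B(2))
      moreover have "?M $$ (i, k) = ?a i k - (if i = k then of_real l else 0)" if "k < n" for k
        using A \<open>i < n\<close> that by (simp add: char_matrix_def)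
      ultimately show ?thesis by simp
    qed
    with sing show False by (auto dest: spec[of _ "\<lambda>k j. B $$ (k, j)"])
  qed
  then have "eigenvalue A (of_real l)" using eigenvalue_det[OF A] by blast
  with e have "e \<le> l" by (simp add: smallest_eigenvalue_def)
  then have "e * norm_sq n x \<le> l * norm_sq n x" by (intro mult_right_mono norm_sq_nonneg)
  with l[of x] show ?thesis by simp
qed

definition tr :: "complex mat \<Rightarrow> complex" where
  "tr A = (\<Sum>i<dim_row A. A $$ (i, i))"

lemma tr_mult_index:
  assumes "A \<in> carrier_mat n n" "B \<in> carrier_mat n n"
  shows "tr (A * B) = (\<Sum>i<n. \<Sum>j<n. A $$ (i, j) * B $$ (j, i))"
  using assms by (simp add: tr_def times_mat_index[OF assms] del: index_mult_mat(1))

text \<open>Since P equals P times its adjoint, both traces are sums over the columns of P, and the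
  variational principle applies to each column. With a projection of any rank as trial state, no
  normalized trial vector is required.\<close>

lemma smallest_eigenvalue_le_tr_projection:
  assumes A: "A \<in> carrier_mat n n" and n: "n > 0" and herm: "mat_adjoint A = A"
    and e: "smallest_eigenvalue A e"
    and P: "P \<in> carrier_mat n n" "mat_adjoint P = P" "P * P = P"
  shows "e * Re (tr P) \<le> Re (tr (A * P))"
proof -
  have PP: "(\<Sum>k<n. P $$ (i, k) * cnj (P $$ (j, k))) = P $$ (i, j)" if "i < n" "j < n" for i j
  proof -
    have "P $$ (i, j) = (\<Sum>k<n. P $$ (i, k) * P $$ (k, j))"
      using times_mat_index[OF P(1) P(1) that] by (simp add: P(3))
    then show ?thesis using mat_adjoint_eqD[OF P(2) P(1) _ that(2)] by simp
  qed
  have "tr P = (\<Sum>i<n. \<Sum>k<n. P $$ (i, k) * cnj (P $$ (i, k)))"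
    using P(1) by (simp add: tr_def PP)
  also have "\<dots> = (\<Sum>k<n. of_real (norm_sq n (\<lambda>i. P $$ (i, k))))"
    by (subst sum.swap) (simp add: of_real_norm_sq)
  finally have trP: "Re (tr P) = (\<Sum>k<n. norm_sq n (\<lambda>i. P $$ (i, k)))"
    by simp
  have "tr (A * P) = (\<Sum>i<n. \<Sum>j<n. A $$ (i, j) * P $$ (j, i))"
    by (rule tr_mult_index[OF A P(1)])
  also have "\<dots> = (\<Sum>i<n. \<Sum>j<n. \<Sum>k<n. A $$ (i, j) * P $$ (j, k) * cnj (P $$ (i, k)))"
    unfolding mult.assoc sum_distrib_left[symmetric] by (intro sum.cong refl) (simp add: PP)
  also have "\<dots> = (\<Sum>i<n. \<Sum>k<n. \<Sum>j<n. A $$ (i, j) * P $$ (j, k) * cnj (P $$ (i, k)))"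
    by (intro sum.cong refl sum.swap)
  also have "\<dots> = (\<Sum>k<n. form n (\<lambda>i j. A $$ (i, j)) (\<lambda>i. P $$ (i, k)) (\<lambda>i. P $$ (i, k)))"
    unfolding form_def by (rule sum.swap)
  finally have trAP: "Re (tr (A * P))
      = (\<Sum>k<n. Re (form n (\<lambda>i j. A $$ (i, j)) (\<lambda>i. P $$ (i, k)) (\<lambda>i. P $$ (i, k))))"
    by simp
  show ?thesis
    unfolding trP trAP sum_distrib_left
    by (intro sum_mono smallest_eigenvalue_le_form[OF A n herm e])
qed

section \<open>Kronecker products\<close>

text \<open>Decodes the flattened index \<open>i * n + j\<close> of a Kronecker product into its two
  components.\<close>

lemma sum_div_mod:
  fixes f :: "nat \<Rightarrow> nat \<Rightarrow> 'a::comm_monoid_add"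
  shows "(\<Sum>k<m * n. f (k div n) (k mod n)) = (\<Sum>i<m. \<Sum>j<n. f i j)"
proof -
  have bound: "i * n + j < m * n" if "i < m" "j < n" for i j
  proof -
    have "i * n + j < Suc i * n" using that by simp
    also have "\<dots> \<le> m * n" using that by (intro mult_right_mono) auto
    finally show ?thesis .
  qed
  have "(\<Sum>k<m * n. f (k div n) (k mod n)) = (\<Sum>(i, j)\<in>{..<m} \<times> {..<n}. f i j)"
  proof (rule sum.reindex_bij_witness[of _ "\<lambda>(i, j). i * n + j" "\<lambda>k. (k div n, k mod n)"])
    fix k assume "k \<in> {..<m * n}"
    then have "k < m * n" "n > 0" by (auto intro: Nat.gr0I)
    then show "(k div n, k mod n) \<in> {..<m} \<times> {..<n}" by (simp add: less_mult_imp_div_less)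
  qed (auto simp: bound)
  then show ?thesis by (simp add: sum.cartesian_product)
qed

lemma dim_kron [simp]:
  "dim_row (kron A B) = dim_row A * dim_row B" "dim_col (kron A B) = dim_col A * dim_col B"
  by (simp_all add: kron_def)

lemma kron_carrier:
  "A \<in> carrier_mat m n \<Longrightarrow> B \<in> carrier_mat p q \<Longrightarrow> kron A B \<in> carrier_mat (m * p) (n * q)"
  by (auto intro: carrier_matI)

lemma kron_index:
  assumes "i < dim_row A * dim_row B" "j < dim_col A * dim_col B"
  shows "kron A B $$ (i, j) = A $$ (i div dim_row B, j div dim_col B) * B $$ (i mod dim_row B, j mod dim_col B)"
  using assms by (simp add: kron_def)

lemma div_mod_less:
  fixes i m n :: nat
  assumes "i < m * n"
  shows "i div n < m" "i mod n < n"
  using assms by (auto simp: less_mult_imp_div_less intro!: mod_less_divisor Nat.gr0I)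

lemma kron_mult:
  assumes A: "A \<in> carrier_mat m n" and B: "B \<in> carrier_mat p q"
    and C: "C \<in> carrier_mat n m'" and D: "D \<in> carrier_mat q p'"
  shows "kron A B * kron C D = kron (A * C) (B * D)"
proof (rule eq_matI)
  fix i j assume "i < dim_row (kron (A * C) (B * D))" "j < dim_col (kron (A * C) (B * D))"
  then have i: "i < m * p" and j: "j < m' * p'" using A B C D by auto
  have AB: "kron A B \<in> carrier_mat (m * p) (n * q)" and CD: "kron C D \<in> carrier_mat (n * q) (m' * p')"
    using A B C D by (auto intro: kron_carrier)
  have "(kron A B * kron C D) $$ (i, j) = (\<Sum>k<n * q. kron A B $$ (i, k) * kron C D $$ (k, j))"
    by (rule times_mat_index[OF AB CD i j])
  also have "\<dots> = (\<Sum>k<n * q. A $$ (i div p, k div q) * C $$ (k div q, j div p')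
      * (B $$ (i mod p, k mod q) * D $$ (k mod q, j mod p')))"
    using A B C D i j by (intro sum.cong refl) (simp add: kron_index mult_ac)
  also have "\<dots> = (\<Sum>k<n. \<Sum>l<q. A $$ (i div p, k) * C $$ (k, j div p')
      * (B $$ (i mod p, l) * D $$ (l, j mod p')))"
    by (rule sum_div_mod)
  also have "\<dots> = (A * C) $$ (i div p, j div p') * (B * D) $$ (i mod p, j mod p')"
    using div_mod_less[OF i] div_mod_less[OF j]
    by (simp add: times_mat_index[OF A C] times_mat_index[OF B D] sum_product del: index_mult_mat(1))
  also have "\<dots> = kron (A * C) (B * D) $$ (i, j)"
    using A B C D i j by (subst kron_index) auto
  finally show "(kron A B * kron C D) $$ (i, j) = kron (A * C) (B * D) $$ (i, j)" .
qed (use A B C D in auto)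

lemma kron_assoc: "kron (kron A B) C = kron A (kron B C)"
proof (rule eq_matI)
  fix i j assume "i < dim_row (kron A (kron B C))" "j < dim_col (kron A (kron B C))"
  then have i: "i < dim_row A * dim_row B * dim_row C" and j: "j < dim_col A * dim_col B * dim_col C"
    by (simp_all add: mult.assoc)
  have i': "i mod (dim_row B * dim_row C) < dim_row B * dim_row C"
    using i by (intro mod_less_divisor Nat.gr0I) auto
  have j': "j mod (dim_col B * dim_col C) < dim_col B * dim_col C"
    using j by (intro mod_less_divisor Nat.gr0I) auto
  \<comment> \<open>An index has three mixed-radix digits, and both groupings of the triple product
    extract the same ones. The side condition yields \<open>c > 0\<close>, which the second identity
    requires.\<close>
  have split: "k div (b * c) = k div c div b" "k mod (b * c) div c = k div c mod b"
      "k mod (b * c) mod c = k mod c"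
    if "k mod (b * c) < b * c" for k b c :: nat
  proof -
    show "k div (b * c) = k div c div b" by (metis div_mult2_eq mult.commute)
    have "c > 0" using that by (auto intro: Nat.gr0I)
    moreover have "k mod (b * c) = c * (k div c mod b) + k mod c"
      by (metis mod_mult2_eq mult.commute)
    ultimately show "k mod (b * c) div c = k div c mod b" by simp
    show "k mod (b * c) mod c = k mod c" by (simp add: mod_mod_cancel)
  qed
  show "kron (kron A B) C $$ (i, j) = kron A (kron B C) $$ (i, j)"
    using i j i' j' div_mod_less[OF i] div_mod_less[OF j]
    by (simp add: kron_index split[OF i'] split[OF j'] mult.assoc)
qed (simp_all add: mult.assoc)

lemma tr_kron:
  assumes "A \<in> carrier_mat m m" "B \<in> carrier_mat n n"
  shows "tr (kron A B) = tr A * tr B"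
proof -
  have "tr (kron A B) = (\<Sum>k<m * n. A $$ (k div n, k div n) * B $$ (k mod n, k mod n))"
    using assms by (simp add: tr_def kron_index)
  also have "\<dots> = (\<Sum>i<m. \<Sum>j<n. A $$ (i, i) * B $$ (j, j))"
    by (rule sum_div_mod)
  finally show ?thesis using assms by (simp add: tr_def sum_product)
qed

lemma mat_adjoint_kron:
  assumes "A \<in> carrier_mat m m" "B \<in> carrier_mat n n" "mat_adjoint A = A" "mat_adjoint B = B"
  shows "mat_adjoint (kron A B) = kron A B"
proof (rule mat_adjoint_eqI)
  show "kron A B \<in> carrier_mat (m * n) (m * n)" using assms by (simp add: kron_carrier)
  show "cnj (kron A B $$ (j, i)) = kron A B $$ (i, j)" if "i < m * n" "j < m * n" for i j
    using assms that div_mod_less[OF that(1)] div_mod_less[OF that(2)]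
      mat_adjoint_eqD[OF assms(3,1)] mat_adjoint_eqD[OF assms(4,2)]
    by (simp add: kron_index)
qed

section \<open>Tensor products over a list of qubits\<close>

lemma tensor_list_carrier:
  assumes "\<And>x. x \<in> set xs \<Longrightarrow> X x \<in> carrier_mat 2 2"
  shows "tensor_list (map X xs) \<in> carrier_mat (2 ^ length xs) (2 ^ length xs)"
  using assms
proof (induction xs)
  case (Cons x xs)
  then have "X x \<in> carrier_mat 2 2" "tensor_list (map X xs) \<in> carrier_mat (2 ^ length xs) (2 ^ length xs)"
    by auto
  then show ?case using kron_carrier by fastforce
qed simp

lemma tensor_list_mult:
  assumes "\<And>x. x \<in> set xs \<Longrightarrow> X x \<in> carrier_mat 2 2" "\<And>x. x \<in> set xs \<Longrightarrow> Y x \<in> carrier_mat 2 2"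
  shows "tensor_list (map X xs) * tensor_list (map Y xs) = tensor_list (map (\<lambda>x. X x * Y x) xs)"
  using assms
proof (induction xs)
  case (Cons x xs)
  have "tensor_list (map X xs) \<in> carrier_mat (2 ^ length xs) (2 ^ length xs)"
      "tensor_list (map Y xs) \<in> carrier_mat (2 ^ length xs) (2 ^ length xs)"
    using Cons.prems by (auto intro!: tensor_list_carrier)
  with Cons show ?case by (simp add: kron_mult[of _ 2 2 _ "2 ^ length xs" "2 ^ length xs" _ 2 _ "2 ^ length xs"])
qed simp

lemma tr_tensor_list:
  assumes "\<And>x. x \<in> set xs \<Longrightarrow> X x \<in> carrier_mat 2 2"
  shows "tr (tensor_list (map X xs)) = (\<Prod>x\<leftarrow>xs. tr (X x))"
  using assms
proof (induction xs)
  case Nil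
  show ?case by (simp add: tr_def)
next
  case (Cons x xs)
  have "tensor_list (map X xs) \<in> carrier_mat (2 ^ length xs) (2 ^ length xs)"
    using Cons.prems by (auto intro!: tensor_list_carrier)
  with Cons show ?case by (simp add: tr_kron[of _ 2 _ "2 ^ length xs"])
qed

lemma mat_adjoint_one: "mat_adjoint (1\<^sub>m n :: complex mat) = 1\<^sub>m n"
  by (rule mat_adjoint_eqI) auto

lemma mat_adjoint_tensor_list:
  assumes "\<And>x. x \<in> set xs \<Longrightarrow> X x \<in> carrier_mat 2 2" "\<And>x. x \<in> set xs \<Longrightarrow> mat_adjoint (X x) = X x"
  shows "mat_adjoint (tensor_list (map X xs)) = tensor_list (map X xs)"
  using assms
proof (induction xs)
  case Nil
  show ?case by (simp add: mat_adjoint_one)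
next
  case (Cons x xs)
  have "tensor_list (map X xs) \<in> carrier_mat (2 ^ length xs) (2 ^ length xs)"
    using Cons.prems by (auto intro!: tensor_list_carrier)
  with Cons show ?case by (simp add: mat_adjoint_kron[of _ 2 _ "2 ^ length xs"])
qed

section \<open>The Hamiltonian as a sum of bonds\<close>

text \<open>The two-site interaction as one tensor product, so that traces against other tensor
  products factor over sites; \<open>Suc l mod N\<close> closes the ring.\<close>

definition bond :: "nat \<Rightarrow> complex mat \<Rightarrow> nat \<Rightarrow> complex mat" where
  "bond N A l = tensor_list (map (\<lambda>i. if i = l \<or> i = Suc l mod N then A else 1\<^sub>m 2) [0..<N])"

definition paulis :: "complex mat list" where
  "paulis = [pauli_x, pauli_y, pauli_z]"

lemma pauli_index:
  "pauli_x $$ (0, 0) = 0" "pauli_x $$ (0, Suc 0) = 1" "pauli_x $$ (Suc 0, 0) = 1" "pauli_x $$ (Suc 0, Suc 0) = 0"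
  "pauli_y $$ (0, 0) = 0" "pauli_y $$ (0, Suc 0) = - \<i>" "pauli_y $$ (Suc 0, 0) = \<i>" "pauli_y $$ (Suc 0, Suc 0) = 0"
  "pauli_z $$ (0, 0) = 1" "pauli_z $$ (0, Suc 0) = 0" "pauli_z $$ (Suc 0, 0) = 0" "pauli_z $$ (Suc 0, Suc 0) = - 1"
  by (simp_all add: pauli_x_def pauli_y_def pauli_z_def mat_of_rows_list_def)

lemma pauli_carrier [simp]:
  "pauli_x \<in> carrier_mat 2 2" "pauli_y \<in> carrier_mat 2 2" "pauli_z \<in> carrier_mat 2 2"
  by (auto simp: pauli_x_def pauli_y_def pauli_z_def mat_of_rows_list_def intro!: carrier_matI)

lemma paulis_carrier: "A \<in> set paulis \<Longrightarrow> A \<in> carrier_mat 2 2"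
  by (auto simp: paulis_def)

lemma mat_adjoint_paulis: "A \<in> set paulis \<Longrightarrow> mat_adjoint A = A"
  by (rule mat_adjoint_eqI[of _ 2]) (auto simp: paulis_def pauli_index less_2_cases_iff)

lemma bond_carrier: "A \<in> carrier_mat 2 2 \<Longrightarrow> bond N A l \<in> carrier_mat (2 ^ N) (2 ^ N)"
  unfolding bond_def using tensor_list_carrier[of "[0..<N]"] by auto

lemma mat_adjoint_bond: "A \<in> set paulis \<Longrightarrow> mat_adjoint (bond N A l) = bond N A l"
  unfolding bond_def
  by (intro mat_adjoint_tensor_list) (auto simp: mat_adjoint_paulis mat_adjoint_one paulis_carrier)

lemma Suc_mod_neq: "N \<ge> 2 \<Longrightarrow> l < N \<Longrightarrow> Suc l mod N \<noteq> l"
  by (cases "Suc l = N") auto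

text \<open>For \<open>N \<ge> 2\<close> the two sites differ, so at every site at least one of the
  multiplied factors is the identity.\<close>

lemma site_op_mult:
  assumes "A \<in> carrier_mat 2 2" "N \<ge> 2" "l < N"
  shows "site_op N A l * site_op N A (Suc l mod N) = bond N A l"
  using assms Suc_mod_neq[of N l] unfolding site_op_def bond_def
  by (subst tensor_list_mult) (auto intro!: arg_cong[of _ _ tensor_list])

lemma H_XXX_index:
  assumes "N \<ge> 2" "i < 2 ^ N" "j < 2 ^ N"
  shows "H_XXX J N $$ (i, j) = of_real J * (\<Sum>l<N. \<Sum>A\<leftarrow>paulis. bond N A l $$ (i, j))"
proof -
  have dims: "dim_row (bond N A l) = 2 ^ N" "dim_col (bond N A l) = 2 ^ N" if "A \<in> set paulis" for A l
    using bond_carrier[of A N l] paulis_carrier[OF that] by auto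
  show ?thesis
    using assms dims unfolding H_XXX_def msum_def
    by (auto simp: site_op_mult paulis_def intro!: sum.cong)
qed

lemma H_XXX_carrier: "H_XXX J N \<in> carrier_mat (2 ^ N) (2 ^ N)"
  by (simp add: H_XXX_def msum_def)

lemma mat_adjoint_H_XXX:
  assumes "N \<ge> 2"
  shows "mat_adjoint (H_XXX J N) = H_XXX J N"
proof (rule mat_adjoint_eqI[OF H_XXX_carrier])
  fix i j :: nat assume ij: "i < 2 ^ N" "j < 2 ^ N"
  have "cnj (bond N A l $$ (j, i)) = bond N A l $$ (i, j)" if "A \<in> set paulis" for A l
    using mat_adjoint_eqD[OF mat_adjoint_bond[OF that] bond_carrier ij] that by (simp add: paulis_carrier)
  then show "cnj (H_XXX J N $$ (j, i)) = H_XXX J N $$ (i, j)"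
    using assms ij by (simp add: H_XXX_index paulis_def)
qed

lemma tr_H_XXX_mult:
  assumes N: "N \<ge> 2" and B: "B \<in> carrier_mat (2 ^ N) (2 ^ N)"
  shows "tr (H_XXX J N * B) = of_real J * (\<Sum>l<N. \<Sum>A\<leftarrow>paulis. tr (bond N A l * B))"
proof -
  have "tr (H_XXX J N * B) = (\<Sum>i<2^N. \<Sum>j<2^N. of_real J * (\<Sum>l<N. \<Sum>A\<leftarrow>paulis. bond N A l $$ (i, j) * B $$ (j, i)))"
    using N by (simp add: tr_mult_index[OF H_XXX_carrier B] H_XXX_index sum_distrib_right
        paulis_def distrib_right mult.assoc)
  also have "\<dots> = of_real J * (\<Sum>i<2^N. \<Sum>l<N. \<Sum>j<2^N. \<Sum>A\<leftarrow>paulis. bond N A l $$ (i, j) * B $$ (j, i))"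
    unfolding sum_distrib_left[symmetric] by (intro arg_cong2[of _ _ _ _ "(*)"] sum.cong refl sum.swap)
  also have "\<dots> = of_real J * (\<Sum>l<N. \<Sum>i<2^N. \<Sum>j<2^N. \<Sum>A\<leftarrow>paulis. bond N A l $$ (i, j) * B $$ (j, i))"
    by (intro arg_cong2[of _ _ _ _ "(*)"] refl sum.swap)
  also have "\<dots> = of_real J * (\<Sum>l<N. \<Sum>A\<leftarrow>paulis. tr (bond N A l * B))"
    using tr_mult_index[OF bond_carrier[OF paulis_carrier] B, symmetric]
    by (simp add: paulis_def sum.distrib)
  finally show ?thesis .
qed

section \<open>Dimer coverings\<close>

text \<open>The projection onto $(|01\<rangle> - |10\<rangle>) / \<surd>2$.\<close>

definition singlet :: "complex mat" where
  "singlet = mat 4 4 (\<lambda>(i, j). if i \<in> {1, 2} \<and> j \<in> {1, 2} then if i = j then 1 / 2 else - 1 / 2 else 0)"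

text \<open>Singlets sit on the pairs of sites \<open>2 * j\<close>, \<open>2 * j + 1\<close>. For
  odd \<open>n\<close> the last site stays unpaired and carries the identity, which makes the
  projection one of trace 2 instead of 1.\<close>

fun dimers :: "nat \<Rightarrow> complex mat" where
  "dimers 0 = 1\<^sub>m 1"
| "dimers (Suc 0) = 1\<^sub>m 2"
| "dimers (Suc (Suc n)) = kron singlet (dimers n)"

lemma singlet_carrier: "singlet \<in> carrier_mat 4 4"
  by (simp add: singlet_def)

lemma dimers_carrier: "dimers n \<in> carrier_mat (2 ^ n) (2 ^ n)"
proof (induction n rule: dimers.induct)
  case (3 n)
  then show ?case using kron_carrier[OF singlet_carrier] by simp
qed auto

lemma sum_lessThan_4: "(\<Sum>i<4. f i) = f 0 + f 1 + f 2 + f 3" for f :: "nat \<Rightarrow> 'a::comm_monoid_add"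
  by (simp add: eval_nat_numeral add.assoc)

lemma sum_lessThan_2: "(\<Sum>i<2. f i) = f 0 + f 1" for f :: "nat \<Rightarrow> 'a::comm_monoid_add"
  by (simp add: eval_nat_numeral)

lemma singlet_idem: "singlet * singlet = singlet"
proof (rule eq_matI)
  fix i j assume "i < dim_row singlet" "j < dim_col singlet"
  then have ij: "i < 4" "j < 4" using singlet_carrier by auto
  then have "i \<in> {0, 1, 2, 3}" "j \<in> {0, 1, 2, 3}" by auto
  then show "(singlet * singlet) $$ (i, j) = singlet $$ (i, j)"
    unfolding times_mat_index[OF singlet_carrier singlet_carrier ij] sum_lessThan_4
    by (auto simp: singlet_def)
qed (use singlet_carrier in auto)

lemma mat_adjoint_dimers: "mat_adjoint (dimers n) = dimers n"
proof (induction n rule: dimers.induct)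
  case (3 n)
  have "mat_adjoint singlet = singlet"
    by (rule mat_adjoint_eqI[OF singlet_carrier]) (auto simp: singlet_def)
  with 3 show ?case by (simp add: mat_adjoint_kron[OF singlet_carrier dimers_carrier])
qed (auto simp: mat_adjoint_one)

lemma dimers_idem: "dimers n * dimers n = dimers n"
proof (induction n rule: dimers.induct)
  case (3 n)
  then show ?case
    by (simp add: kron_mult[OF singlet_carrier dimers_carrier singlet_carrier dimers_carrier] singlet_idem)
qed auto

lemma tr_dimers: "tr (dimers n) = (if odd n then 2 else 1)"
proof (induction n rule: dimers.induct)
  case (3 n)
  have "tr singlet = 1"
    using singlet_carrier by (simp add: tr_def sum_lessThan_4 singlet_def)
  with 3 show ?case by (simp add: tr_kron[OF singlet_carrier dimers_carrier])
qed (auto simp: tr_def)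

text \<open>Only the basis indices 1 and 2, that is 01 and 10, meet the singlet. The formula shows
  that equal Pauli matrices on both sites have expectation -1, while a Pauli matrix next to an
  identity has expectation 0.\<close>

lemma tr_kron_singlet:
  assumes "A \<in> carrier_mat 2 2" "B \<in> carrier_mat 2 2"
  shows "tr (kron A B * singlet) = (A $$ (0, 0) * B $$ (1, 1) + A $$ (1, 1) * B $$ (0, 0)
           - A $$ (0, 1) * B $$ (1, 0) - A $$ (1, 0) * B $$ (0, 1)) / 2"
proof -
  have AB: "kron A B \<in> carrier_mat 4 4" using kron_carrier[OF assms] by simp
  show ?thesis
    unfolding tr_mult_index[OF AB singlet_carrier] sum_lessThan_4
    using assms by (simp add: singlet_def kron_index field_simps)
qed

text \<open>Peeling off two sites at a time splits the trace into one factor per dimer, with the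
  unpaired last site contributing its own trace.\<close>

lemma tr_tensor_list_dimers:
  assumes "\<And>i. X i \<in> carrier_mat 2 2"
  shows "tr (tensor_list (map X [0..<n]) * dimers n)
    = (\<Prod>j<n div 2. tr (kron (X (2 * j)) (X (Suc (2 * j))) * singlet)) * (if odd n then tr (X (n - 1)) else 1)"
  using assms
proof (induction n arbitrary: X rule: dimers.induct)
  case 1
  show ?case by (simp add: tr_def)
next
  case 2
  have "kron (X 0) (1\<^sub>m 1) = X 0"
    using 2[of 0] by (intro eq_matI) (auto simp: kron_index)
  with 2[of 0] show ?case by simp
next
  case (3 n)
  let ?T = "tensor_list (map (\<lambda>i. X (Suc (Suc i))) [0..<n])"
  have T: "?T \<in> carrier_mat (2 ^ n) (2 ^ n)"
    using tensor_list_carrier[of "[0..<n]" "\<lambda>i. X (Suc (Suc i))"] 3(2) by simp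
  have XX: "kron (X 0) (X (Suc 0)) \<in> carrier_mat 4 4"
    using kron_carrier[OF 3(2)[of 0] 3(2)[of "Suc 0"]] by simp
  have "[0..<Suc (Suc n)] = 0 # Suc 0 # map (\<lambda>i. Suc (Suc i)) [0..<n]"
    by (simp add: upt_conv_Cons map_Suc_upt[symmetric] comp_def del: upt_Suc)
  then have "tensor_list (map X [0..<Suc (Suc n)]) = kron (kron (X 0) (X (Suc 0))) ?T"
    by (simp add: kron_assoc comp_def del: upt_Suc)
  then have "tr (tensor_list (map X [0..<Suc (Suc n)]) * dimers (Suc (Suc n)))
      = tr (kron (kron (X 0) (X (Suc 0)) * singlet) (?T * dimers n))"
    by (simp add: kron_mult[OF XX T singlet_carrier dimers_carrier] del: upt_Suc)
  also have "\<dots> = tr (kron (X 0) (X (Suc 0)) * singlet) * tr (?T * dimers n)"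
    by (rule tr_kron[of _ 4 _ "2 ^ n"])
      (use XX T singlet_carrier dimers_carrier[of n] in auto)
  also have "tr (?T * dimers n) = (\<Prod>j<n div 2. tr (kron (X (Suc (Suc (2 * j)))) (X (Suc (Suc (Suc (2 * j))))) * singlet))
        * (if odd n then tr (X (Suc (Suc (n - 1)))) else 1)"
    using 3 by simp
  finally show ?case
    \<comment> \<open>The case split handles the truncated \<open>n - 1\<close>: the factor of the
      last site is only present for odd \<open>n\<close>, where \<open>n\<close> is a
      successor.\<close>
    by (cases n) (auto simp: prod.lessThan_Suc_shift simp del: upt_Suc prod.lessThan_Suc)
qed

text \<open>A bond inside a dimer has expectation -1 in it. Any other bond leaves some singlet with
  a single Pauli matrix, whose expectation vanishes. \<open>N \<ge> 3\<close> prevents the closing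
  bond from falling inside the only dimer of a two-site ring.\<close>

lemma tr_bond_dimers:
  assumes A: "A \<in> set paulis" and N: "N \<ge> 3" and l: "l < N"
  shows "tr (bond N A l * dimers N) = (if even l \<and> Suc l < N then - tr (dimers N) else 0)"
proof -
  define X where "X i = (if i = l \<or> i = Suc l mod N then A else 1\<^sub>m 2)" for i
  define s where "s j = tr (kron (X (2 * j)) (X (Suc (2 * j))) * singlet)" for j
  have tr: "tr (bond N A l * dimers N)
    = (\<Prod>j<N div 2. s j) * (if odd N then tr (X (N - 1)) else 1)"
  proof -
    have "bond N A l = tensor_list (map X [0..<N])" by (simp add: bond_def X_def[abs_def])
    moreover have "X i \<in> carrier_mat 2 2" for i using paulis_carrier[OF A] by (simp add: X_def)
    ultimately show ?thesis by (simp add: tr_tensor_list_dimers s_def)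
  qed
  have tr_one: "tr (1\<^sub>m 2) = 2" by (simp add: tr_def)
  have one: "tr (kron (1\<^sub>m 2) (1\<^sub>m 2) * singlet) = 1"
    by (simp add: tr_kron_singlet)
  have half: "tr (kron A (1\<^sub>m 2) * singlet) = 0" "tr (kron (1\<^sub>m 2) A * singlet) = 0"
    using A by (auto simp: tr_kron_singlet paulis_carrier[OF A]) (auto simp: paulis_def pauli_index)
  have full: "tr (kron A A * singlet) = - 1"
    using A by (auto simp: tr_kron_singlet paulis_carrier[OF A]) (auto simp: paulis_def pauli_index)
  consider "even l" "Suc l < N" | "odd l" | "even l" "Suc l = N" using l by linarith
  then show ?thesis
  proof cases
    case 1
    then obtain k where k: "l = 2 * k" by (auto elim: evenE)
    have "s j = (if j = k then - 1 else 1)" for j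
    proof -
      have "Suc (2 * j) \<noteq> 2 * k" "2 * j \<noteq> Suc (2 * k)" by presburger+
      then show ?thesis using 1 k by (auto simp: s_def X_def full one)
    qed
    moreover have "k < N div 2" using 1 k by linarith
    ultimately have "(\<Prod>j<N div 2. s j) = - 1" by (simp add: prod.delta)
    \<comment> \<open>The unpaired site lies off the bond, so it contributes the trace 2 that
      \<open>dimers N\<close> has for odd \<open>N\<close>.\<close>
    moreover have "X (N - 1) = 1\<^sub>m 2" if "odd N"
    proof -
      have "N - 1 \<noteq> Suc l" using that 1 by presburger
      moreover have "N - 1 \<noteq> l" using 1(2) by linarith
      moreover have "Suc l mod N = Suc l" using 1(2) by simp
      ultimately show ?thesis by (simp add: X_def)
    qed
    ultimately show ?thesis using 1 by (simp add: tr tr_dimers tr_one)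
  next
    case 2
    then obtain k where k: "l = Suc (2 * k)" by (auto elim: oddE)
    have "Suc l mod N = 0 \<and> Suc l = N \<or> Suc l mod N = Suc l" using l by (cases "Suc l = N") auto
    \<comment> \<open>Dimer \<open>k\<close> contains the left end \<open>l\<close> of the bond as
      its right site. Its left site is not the other end: that would force \<open>k = 0\<close> and
      \<open>N = 2\<close>.\<close>
    then have "2 * k \<noteq> Suc l mod N" using k N by auto
    then have "s k = 0" using k by (simp add: s_def X_def half)
    moreover have "k < N div 2" using l k by linarith
    ultimately have "(\<Prod>j<N div 2. s j) = 0" by (intro prod_zero) auto
    then show ?thesis using 2 by (simp add: tr)
  next
    case 3
    \<comment> \<open>This is the closing bond of an odd ring, from the unpaired last site to site
      0. It meets dimer 0 at site 0 only.\<close>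
    then have "l \<noteq> Suc 0" by auto
    with 3 have "s 0 = 0" by (simp add: s_def X_def half)
    moreover have "0 < N div 2" using N by linarith
    ultimately have "(\<Prod>j<N div 2. s j) = 0" by (intro prod_zero) auto
    then show ?thesis using 3 by (simp add: tr)
  qed
qed

lemma tr_H_XXX_dimers:
  assumes N: "N \<ge> 3"
  shows "tr (H_XXX J N * dimers N) = of_real (- 3 * J * real (N div 2)) * tr (dimers N)"
proof -
  have "(\<Sum>A\<leftarrow>paulis. tr (bond N A l * dimers N))
      = (if even l \<and> Suc l < N then - 3 * tr (dimers N) else 0)" if "l < N" for l
    using tr_bond_dimers[OF _ N that] by (simp add: paulis_def)
  then have "(\<Sum>l<N. \<Sum>A\<leftarrow>paulis. tr (bond N A l * dimers N))
      = (\<Sum>l<N. if even l \<and> Suc l < N then - 3 * tr (dimers N) else 0)"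
    by simp
  also have "\<dots> = (\<Sum>l\<in>{..<N} \<inter> {l. even l \<and> Suc l < N}. - 3 * tr (dimers N))"
    by (simp add: sum.If_cases)
  \<comment> \<open>The contributing bonds are counted by the dimers, through their left
    ends.\<close>
  also have "{..<N} \<inter> {l. even l \<and> Suc l < N} = (\<lambda>k. 2 * k) ` {..<N div 2}"
    by (auto elim!: evenE)
  finally have sum: "(\<Sum>l<N. \<Sum>A\<leftarrow>paulis. tr (bond N A l * dimers N))
      = of_nat (N div 2) * (- 3 * tr (dimers N))"
    by (simp add: card_image inj_on_def)
  have "tr (H_XXX J N * dimers N) = of_real J * (\<Sum>l<N. \<Sum>A\<leftarrow>paulis. tr (bond N A l * dimers N))"
    using N by (intro tr_H_XXX_mult dimers_carrier) simp
  then show ?thesis by (simp only: sum) simp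
qed

section \<open>The energy of separable states\<close>

lemma density_operatorD:
  assumes "density_operator d R"
  shows "R \<in> carrier_mat d d" "mat_adjoint R = R" "tr R = 1"
    "v \<in> carrier_vec d \<Longrightarrow> 0 \<le> Re ((R *\<^sub>v v) \<bullet>c v)"
  using assms by (auto simp: density_operator_def tr_def)

text \<open>The squared length of the Bloch vector is the squared trace minus four times the
  determinant; the trace is 1, and positivity makes the determinant nonnegative.\<close>

lemma bloch_vector:
  assumes R: "density_operator 2 R"
  shows "A \<in> set paulis \<Longrightarrow> Im (tr (A * R)) = 0"
    and "(\<Sum>A\<leftarrow>paulis. (Re (tr (A * R)))\<^sup>2) \<le> 1"
proof -
  note dims [simp] = carrier_matD[OF density_operatorD(1)[OF R]]
  define a b d where "a = Re (R $$ (0, 0))" and "b = R $$ (0, 1)" and "d = Re (R $$ (1, 1))"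
  note adj = mat_adjoint_eqD[OF density_operatorD(2)[OF R] density_operatorD(1)[OF R]]
  have "Im (R $$ (0, 0)) = 0" "Im (R $$ (1, 1)) = 0"
    using arg_cong[OF adj[of 0 0], of Im] arg_cong[OF adj[of 1 1], of Im] by simp_all
  then have entries: "R $$ (0, 0) = of_real a" "R $$ (Suc 0, Suc 0) = of_real d"
      "R $$ (0, Suc 0) = b" "R $$ (Suc 0, 0) = cnj b"
    using adj[of 1 0] by (simp_all add: a_def b_def d_def complex_eq_iff)
  have tr_mult: "tr (A * R) = A $$ (0, 0) * a + A $$ (0, 1) * cnj b + (A $$ (1, 0) * b + A $$ (1, 1) * d)"
    if "A \<in> carrier_mat 2 2" for A
    using tr_mult_index[OF that density_operatorD(1)[OF R]] by (simp add: sum_lessThan_2 entries)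
  show "A \<in> set paulis \<Longrightarrow> Im (tr (A * R)) = 0"
    by (auto simp: paulis_def tr_mult pauli_index)
  have ad: "a + d = 1"
    using arg_cong[OF density_operatorD(3)[OF R], of Re] by (simp add: tr_def sum_lessThan_2 entries)
  have form: "Re ((R *\<^sub>v vec_of_list [x, y]) \<bullet>c vec_of_list [x, y]) \<ge> 0" for x y
    using density_operatorD(4)[OF R, of "vec_of_list [x, y]"] by (simp add: carrier_vecI)
  have form': "Re ((of_real a * x + b * y) * cnj x + (cnj b * x + of_real d * y) * cnj y) \<ge> 0" for x y
  proof -
    have "(R *\<^sub>v vec_of_list [x, y]) \<bullet>c vec_of_list [x, y]
      = (of_real a * x + b * y) * cnj x + (cnj b * x + of_real d * y) * cnj y"
      by (simp add: scalar_prod_def eval_nat_numeral entries vec_of_list_index conjugate_complex_def)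
    with form[of x y] show ?thesis by simp
  qed
  \<comment> \<open>The test vectors are the columns of the adjugate of \<open>R\<close>. They give
    \<open>a\<close> and \<open>d\<close> times the determinant, and adding the two with
    \<open>a + d = 1\<close> avoids a case distinction on vanishing diagonal entries.\<close>
  have "0 \<le> a * (a * d - (cmod b)\<^sup>2)" "0 \<le> d * (a * d - (cmod b)\<^sup>2)"
    using form'[of "- b" "of_real a"] form'[of "of_real d" "- cnj b"]
    unfolding cmod_power2 by (simp_all add: algebra_simps power2_eq_square)
  then have "0 \<le> (a + d) * (a * d - (cmod b)\<^sup>2)"
    by (simp add: distrib_right)
  then have "(cmod b)\<^sup>2 \<le> a * d" by (simp add: ad)
  moreover have "(\<Sum>A\<leftarrow>paulis. (Re (tr (A * R)))\<^sup>2) = (a + d)\<^sup>2 - 4 * (a * d - (cmod b)\<^sup>2)"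
    unfolding cmod_power2
    by (simp add: paulis_def tr_mult pauli_index algebra_simps power2_eq_square)
  ultimately show "(\<Sum>A\<leftarrow>paulis. (Re (tr (A * R)))\<^sup>2) \<le> 1" by (simp add: ad)
qed

text \<open>Each product of coordinates is at least minus half the sum of their squares, and both
  Bloch vectors have length at most 1. Reality of the traces for \<open>R\<close> alone reduces the
  real part of each product to the product of real parts.\<close>

lemma bond_energy_ge:
  assumes R: "density_operator 2 R" and S: "density_operator 2 S"
  shows "- 1 \<le> Re (\<Sum>A\<leftarrow>paulis. tr (A * R) * tr (A * S))"
proof -
  have im: "Im (tr (pauli_x * R)) = 0" "Im (tr (pauli_y * R)) = 0" "Im (tr (pauli_z * R)) = 0"
    by (rule bloch_vector(1)[OF R], simp add: paulis_def)+
  have amgm: "0 \<le> x\<^sup>2 + y\<^sup>2 + 2 * (x * y)" for x y :: real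
    using zero_le_power2[of "x + y"] by (simp add: power2_sum mult.assoc)
  show ?thesis
    using bloch_vector(2)[OF R] bloch_vector(2)[OF S]
      amgm[of "Re (tr (pauli_x * R))" "Re (tr (pauli_x * S))"]
      amgm[of "Re (tr (pauli_y * R))" "Re (tr (pauli_y * S))"]
      amgm[of "Re (tr (pauli_z * R))" "Re (tr (pauli_z * S))"]
    unfolding paulis_def by (simp add: im)
qed

text \<open>Every site off the bond contributes the trace of its density operator, which is
  1.\<close>

lemma tr_bond_product:
  assumes A: "A \<in> carrier_mat 2 2" and R: "\<And>i. i < N \<Longrightarrow> density_operator 2 (R i)"
    and N: "N \<ge> 2" and l: "l < N"
  shows "tr (bond N A l * tensor_list (map R [0..<N])) = tr (A * R l) * tr (A * R (Suc l mod N))"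
proof -
  define X where "X i = (if i = l \<or> i = Suc l mod N then A else 1\<^sub>m 2)" for i
  have X: "X i \<in> carrier_mat 2 2" for i using A by (simp add: X_def)
  have Rc: "R i \<in> carrier_mat 2 2" if "i < N" for i using density_operatorD(1)[OF R[OF that]] .
  have "bond N A l * tensor_list (map R [0..<N]) = tensor_list (map (\<lambda>i. X i * R i) [0..<N])"
    unfolding bond_def X_def[symmetric] using X Rc by (intro tensor_list_mult) auto
  then have "tr (bond N A l * tensor_list (map R [0..<N])) = (\<Prod>i\<leftarrow>[0..<N]. tr (X i * R i))"
    using X Rc by (subst tr_tensor_list[symmetric]) (auto intro!: mult_carrier_mat[of _ 2 2])
  also have "\<dots> = (\<Prod>i\<in>set [0..<N]. tr (X i * R i))"
    by (rule prod.distinct_set_conv_list[symmetric]) simp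
  also have "\<dots> = (\<Prod>i\<in>{l, Suc l mod N}. tr (X i * R i))"
  proof (rule prod.mono_neutral_right)
    show "\<forall>i\<in>set [0..<N] - {l, Suc l mod N}. tr (X i * R i) = 1"
      using Rc density_operatorD(3)[OF R] by (auto simp: X_def left_mult_one_mat[OF Rc])
  qed (use N l in auto)
  also have "\<dots> = tr (A * R l) * tr (A * R (Suc l mod N))"
    using Suc_mod_neq[OF N l] by (auto simp: X_def)
  finally show ?thesis .
qed

lemma product_energy_ge:
  assumes J: "J \<ge> 0" and N: "N \<ge> 2" and R: "\<And>i. i < N \<Longrightarrow> density_operator 2 (R i)"
  shows "- J * N \<le> Re (tr (H_XXX J N * tensor_list (map R [0..<N])))"
proof -
  have "tensor_list (map R [0..<N]) \<in> carrier_mat (2 ^ N) (2 ^ N)"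
    using tensor_list_carrier[of "[0..<N]" R] density_operatorD(1)[OF R] by simp
  from tr_H_XXX_mult[OF N this, of J]
  have "Re (tr (H_XXX J N * tensor_list (map R [0..<N])))
      = J * (\<Sum>l<N. Re (\<Sum>A\<leftarrow>paulis. tr (bond N A l * tensor_list (map R [0..<N]))))"
    by (simp del: sum_list.Cons)
  also have "\<dots> = J * (\<Sum>l<N. Re (\<Sum>A\<leftarrow>paulis. tr (A * R l) * tr (A * R (Suc l mod N))))"
    using tr_bond_product[OF paulis_carrier R N]
    by (intro arg_cong2[of _ _ _ _ "(*)"] sum.cong refl arg_cong[of _ _ Re] arg_cong[of _ _ sum_list] map_cong) auto
  also have "\<dots> \<ge> J * (\<Sum>l<N. - 1)"
    using N by (intro mult_left_mono[OF _ J] sum_mono bond_energy_ge R) auto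
  finally show ?thesis by simp
qed

lemma tr_mult_msum:
  assumes "A \<in> carrier_mat d d" "\<And>k. k \<in> I \<Longrightarrow> F k \<in> carrier_mat d d"
  shows "tr (A * msum d (\<lambda>k. q k \<cdot>\<^sub>m F k) I) = (\<Sum>k\<in>I. q k * tr (A * F k))"
proof -
  have "msum d (\<lambda>k. q k \<cdot>\<^sub>m F k) I \<in> carrier_mat d d" by (simp add: msum_def)
  then have "tr (A * msum d (\<lambda>k. q k \<cdot>\<^sub>m F k) I)
      = (\<Sum>i<d. \<Sum>j<d. \<Sum>k\<in>I. q k * (A $$ (i, j) * F k $$ (j, i)))"
    using carrier_matD[OF assms(2)]
    by (simp add: tr_mult_index[OF assms(1)] msum_def sum_distrib_left mult_ac)
  also have "\<dots> = (\<Sum>k\<in>I. q k * (\<Sum>i<d. \<Sum>j<d. A $$ (i, j) * F k $$ (j, i)))"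
    by (simp add: sum_distrib_left sum.swap[of _ I])
  also have "\<dots> = (\<Sum>k\<in>I. q k * tr (A * F k))"
    using assms by (intro sum.cong refl) (simp add: tr_mult_index)
  finally show ?thesis .
qed

text \<open>The energy is linear in the state, so the bound for product states passes to convex
  combinations.\<close>

lemma separable_energy_ge:
  assumes J: "J \<ge> 0" and N: "N \<ge> 2" and sep: "fully_separable (replicate N 2) \<rho>"
  shows "- J * N \<le> Re (tr (H_XXX J N * \<rho>))"
proof -
  from sep obtain m and q :: "nat \<Rightarrow> real" and R where
    q: "\<And>k. k < m \<Longrightarrow> 0 \<le> q k" "(\<Sum>k<m. q k) = 1" and
    R: "\<And>k i. k < m \<Longrightarrow> i < N \<Longrightarrow> density_operator 2 (R k i)" and
    \<rho>: "\<rho> = msum (2 ^ N) (\<lambda>k. of_real (q k) \<cdot>\<^sub>m tensor_list (map (R k) [0..<N])) {..<m}"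
    unfolding fully_separable_def length_replicate prod_list_replicate
    by - (elim exE conjE, rule that, auto)
  have carrier: "tensor_list (map (R k) [0..<N]) \<in> carrier_mat (2 ^ N) (2 ^ N)" if "k < m" for k
    using tensor_list_carrier[of "[0..<N]" "R k"] density_operatorD(1)[OF R[OF that]] by simp
  have "- J * N = (\<Sum>k<m. q k * (- J * N))"
    unfolding sum_distrib_right[symmetric] q(2) by simp
  also have "\<dots> \<le> (\<Sum>k<m. q k * Re (tr (H_XXX J N * tensor_list (map (R k) [0..<N]))))"
    using q(1) R by (intro sum_mono mult_left_mono product_energy_ge J N) auto
  also have "\<dots> = Re (tr (H_XXX J N * \<rho>))"
  proof -
    have "tr (H_XXX J N * \<rho>) = (\<Sum>k<m. of_real (q k) * tr (H_XXX J N * tensor_list (map (R k) [0..<N])))"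
      unfolding \<rho> using carrier by (intro tr_mult_msum H_XXX_carrier) auto
    then show ?thesis by simp
  qed
  finally show ?thesis .
qed

section \<open>Ground state energy and conclusion\<close>

text \<open>The columns of the state are its values at unit vectors, hence lie in the eigenspace; so
  the diagonals of \<open>H * \<rho>\<close> and \<open>c\<close> times \<open>\<rho>\<close>
  agree.\<close>

lemma tr_mult_ground_state:
  assumes H: "H \<in> carrier_mat n n" and \<rho>: "\<rho> \<in> carrier_mat n n" "tr \<rho> = 1"
    and range: "\<And>v. v \<in> carrier_vec n \<Longrightarrow> \<rho> *\<^sub>v v \<in> eigenspace H c"
  shows "tr (H * \<rho>) = c"
proof -
  have "(H * \<rho>) $$ (i, i) = c * \<rho> $$ (i, i)" if i: "i < n" for i
  proof -
    have "H *\<^sub>v (\<rho> *\<^sub>v unit_vec n i) = c \<cdot>\<^sub>v (\<rho> *\<^sub>v unit_vec n i)"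
      using range[of "unit_vec n i"] by (simp add: eigenspace_def)
    moreover have "\<rho> *\<^sub>v unit_vec n i = col \<rho> i"
      using \<rho>(1) i by (intro eq_vecI) auto
    ultimately have "(H *\<^sub>v col \<rho> i) $ i = (c \<cdot>\<^sub>v col \<rho> i) $ i" by simp
    then show ?thesis using H \<rho>(1) i by simp
  qed
  then have "tr (H * \<rho>) = c * tr \<rho>"
    using H \<rho>(1) by (simp add: tr_def sum_distrib_left del: index_mult_mat(1))
  with \<rho>(2) show ?thesis by simp
qed

theorem lemma5:
  fixes J :: real
  assumes "J > 0"
  shows "\<forall>\<^sub>F N in sequentially. \<forall>\<rho>. ground_state (H_XXX J N) \<rho> \<longrightarrow> entangled (replicate N 2) \<rho>"
\<comment> \<open>From 4 sites on, three times \<open>N div 2\<close> exceeds \<open>N\<close>; for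
  3 sites the two energy bounds coincide.\<close>
proof (rule eventually_sequentiallyI[of 4], intro allI impI)
  fix N \<rho>
  assume N: "4 \<le> N" and ground: "ground_state (H_XXX J N) \<rho>"
  have H: "H_XXX J N \<in> carrier_mat (2 ^ N) (2 ^ N)" by (rule H_XXX_carrier)
  from ground H obtain e where \<rho>: "density_operator (2 ^ N) \<rho>" and e: "smallest_eigenvalue (H_XXX J N) e"
    and range: "\<And>v. v \<in> carrier_vec (2 ^ N) \<Longrightarrow> \<rho> *\<^sub>v v \<in> eigenspace (H_XXX J N) (of_real e)"
    by (auto simp: ground_state_def)
  have "\<not> fully_separable (replicate N 2) \<rho>"
  proof
    assume "fully_separable (replicate N 2) \<rho>"
    then have "- J * N \<le> Re (tr (H_XXX J N * \<rho>))"
      using assms N by (intro separable_energy_ge) auto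
    also have "tr (H_XXX J N * \<rho>) = of_real e"
      by (rule tr_mult_ground_state[OF H density_operatorD(1,3)[OF \<rho>] range])
    finally have "- J * N \<le> e" by simp
    moreover have "e \<le> - 3 * J * (N div 2)"
    proof -
      have "e * Re (tr (dimers N)) \<le> Re (tr (H_XXX J N * dimers N))"
        using N by (intro smallest_eigenvalue_le_tr_projection[OF H _ _ e] dimers_carrier
            mat_adjoint_H_XXX mat_adjoint_dimers dimers_idem) auto
      also have "\<dots> = - 3 * J * (N div 2) * Re (tr (dimers N))"
        using N by (simp add: tr_H_XXX_dimers)
      \<comment> \<open>The trace of \<open>dimers N\<close> is 1 or 2, so it can be
        cancelled.\<close>
      finally show ?thesis by (rule mult_right_le_imp_le) (simp add: tr_dimers)
    qed
    ultimately have "J * (3 * real (N div 2)) \<le> J * real N" by simp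
    then have "real (3 * (N div 2)) \<le> real N" using assms by simp
    then have "3 * (N div 2) \<le> N" by (simp only: of_nat_le_iff)
    with N show False by linarith
  qed
  with \<rho> show "entangled (replicate N 2) \<rho>"
    by (simp add: entangled_def prod_list_replicate)
qed

end
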